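(* Let $n\ge 0$ and $0\le k\le n$. The number of pairs $(T,M)$, where $T$ is a binary tree on $n+1$ vertices and $M$ is a set of exactly $k$ vertices of $T$ containing no vertex of the right spine of $T$, equals $B_{n,k}$.
   Context: A binary tree is a rooted plane tree in which each vertex has at most two children, each designated as a left or right child. The right spine of $T$ consists of the root and every vertex $u$ such that each vertex on the path from the root to $u$ (other than the root) is the right child of its parent. Catalan's triangle: $C_{n,s}=\frac{n-s+1}{n+1}\binom{n+s}{n}$; Borel's triangle: $B_{n,k}=\sum_{s=k}^{n}\binom{s}{k}C_{n,s}$. *)

theory Defs
  imports Complex_Main "HOL-Library.Tree" "HOL-Library.Sublist"
begin

(* Binary trees are values of the library type "unit tree": a Node is a vertex, a Leaf is an
   absent child.  A vertex is identified with its address, the list of left/right steps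
   leading to it from the root; the root is [], and the vertices on the path from the
   root to u are the prefixes of u. *)

datatype side = Lft | Rgt

fun vertices :: "'a tree \<Rightarrow> side list set" where
  "vertices Leaf = {}"
| "vertices (Node l a r) =
     insert [] ((#) Lft ` vertices l \<union> (#) Rgt ` vertices r)"

definition is_right_child :: "side list \<Rightarrow> bool" where
  "is_right_child v \<longleftrightarrow> v \<noteq> [] \<and> last v = Rgt"

definition right_spine :: "'a tree \<Rightarrow> side list set" where
  "right_spine t = {u \<in> vertices t. \<forall>v. prefix v u \<and> v \<noteq> [] \<longrightarrow> is_right_child v}"

definition catalan_triangle :: "nat \<Rightarrow> nat \<Rightarrow> rat" where
  "catalan_triangle n s =
     (of_nat n - of_nat s + 1) / (of_nat n + 1) * of_nat ((n + s) choose n)"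

definition borel_triangle :: "nat \<Rightarrow> nat \<Rightarrow> rat" where
  "borel_triangle n k = (\<Sum>s = k..n. of_nat (s choose k) * catalan_triangle n s)"

lemma finite_vertices: "finite (vertices t)"
  by (induction t) auto

lemma card_vertices: "card (vertices t) = size t"
proof (induction t)
  case (Node l a r)
  have "card ((#) Lft ` vertices l \<union> (#) Rgt ` vertices r) = size l + size r"
    using Node by (subst card_Un_disjoint) (auto simp: finite_vertices card_image)
  moreover have "[] \<notin> (#) Lft ` vertices l \<union> (#) Rgt ` vertices r"
    by auto
  ultimately show ?case
    by (simp add: finite_vertices)
qed simp

lemma prefix_vertices: "u \<in> vertices t \<Longrightarrow> prefix v u \<Longrightarrow> v \<in> vertices t"
  by (induction t arbitrary: u v) (auto simp: prefix_Cons)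

end

theory Submission imports Defs begin

text \<open>
  Summing over the trees with exactly \<open>s\<close> vertices off the right spine reduces the claim to
  showing that \<open>C\<^bsub>n,s\<^esub>\<close> counts the trees on \<open>n + 1\<close> vertices with \<open>s\<close> vertices off the
  spine. These numbers obey \<open>C\<^bsub>n,s\<^esub> = C\<^bsub>n-1,s\<^esub> + C\<^bsub>n,s-1\<^esub>\<close>: if the root has no left
  child, delete it; otherwise rotate at the root to the right, which moves exactly the left
  child of the root onto the spine.
\<close>

text \<open>Recursive count of the vertices off the right spine: the spine continues only into the
  right subtree, so all of \<open>l\<close> counts.\<close>

fun off_spine :: "'a tree \<Rightarrow> nat" where
  "off_spine Leaf = 0"
| "off_spine (Node l a r) = size l + off_spine r"

lemma right_spine_Leaf [simp]: "right_spine Leaf = {}"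
  by (simp add: right_spine_def)

lemma right_spine_Node:
  "right_spine (Node l a r) = insert [] ((#) Rgt ` right_spine r)"
proof (intro set_eqI)
  fix u :: "side list"
  show "u \<in> right_spine (Node l a r) \<longleftrightarrow> u \<in> insert [] ((#) Rgt ` right_spine r)"
  proof (cases u)
    case Nil
    then show ?thesis by (simp add: right_spine_def)
  next
    case (Cons x w)
    have "(\<forall>v. prefix v (x # w) \<and> v \<noteq> [] \<longrightarrow> is_right_child v) \<longleftrightarrow>
        (\<forall>v. prefix v w \<longrightarrow> is_right_child (x # v))"
      by (auto simp: prefix_Cons)
    \<comment> \<open>The instance \<open>v = []\<close> forces \<open>x = Rgt\<close>; for nonempty
      \<open>v\<close> the last step of \<open>x # v\<close> is that of \<open>v\<close>.\<close>
    also have "\<dots> \<longleftrightarrow> x = Rgt \<and> (\<forall>v. prefix v w \<and> v \<noteq> [] \<longrightarrow> is_right_child v)"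
      by (auto simp: is_right_child_def split: if_splits)
    finally show ?thesis
      using Cons by (auto simp: right_spine_def)
  qed
qed

lemma card_vertices_minus_right_spine:
  "card (vertices t - right_spine t) = off_spine t"
proof (induction t)
  case (Node l a r)
  have "vertices (Node l a r) - right_spine (Node l a r) =
      (#) Lft ` vertices l \<union> (#) Rgt ` (vertices r - right_spine r)"
    by (auto simp: right_spine_Node)
  also have "card \<dots> = size l + off_spine r"
    using Node.IH by (subst card_Un_disjoint)
      (auto simp: finite_vertices card_image card_vertices)
  finally show ?case by simp
qed simp

lemma off_spine_le_size: "off_spine t \<le> size t"
  by (induction t) auto

text \<open>The root is itself on the spine.\<close>

lemma off_spine_le: "size t = Suc n \<Longrightarrow> off_spine t \<le> n"
  using off_spine_le_size[of "right t"] by (cases t) auto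

lemma finite_trees_of_size: "finite {t :: 'a :: finite tree. size t = n}"
proof (induction n rule: less_induct)
  case (less n)
  let ?S = "\<Union>m<n. {t :: 'a tree. size t = m}"
  have "{t. size t = n} \<subseteq> insert Leaf ((\<lambda>(l, a, r). Node l a r) ` (?S \<times> UNIV \<times> ?S))"
  proof
    fix t :: "'a tree" assume "t \<in> {t. size t = n}"
    then show "t \<in> insert Leaf ((\<lambda>(l, a, r). Node l a r) ` (?S \<times> UNIV \<times> ?S))"
      by (cases t) (auto simp: image_iff)
  qed
  moreover have "finite ?S" using less by auto
  ultimately show ?case
    by (elim finite_subset) (intro finite.insertI finite_imageI finite_cartesian_product finite_UNIV)
qed

definition spine_trees :: "nat \<Rightarrow> nat \<Rightarrow> unit tree set" where
  "spine_trees m s = {t. size t = m \<and> off_spine t = s}"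

lemma finite_spine_trees: "finite (spine_trees m s)"
  unfolding spine_trees_def by (rule finite_subset[OF _ finite_trees_of_size[of m]]) auto

lemma spine_trees_empty: "n < s \<Longrightarrow> spine_trees (Suc n) s = {}"
  by (auto simp: spine_trees_def dest: off_spine_le)

text \<open>Inverse of the right rotation at the root: the old root becomes a left child, so exactly
  one vertex leaves the spine. The second equation only makes the function total.\<close>

fun rotate_left :: "unit tree \<Rightarrow> unit tree" where
  "rotate_left (Node a x (Node b y c)) = Node (Node a x b) y c"
| "rotate_left t = t"

lemma card_spine_trees_Suc_Suc:
  assumes "s \<le> n"
  shows "card (spine_trees (Suc (Suc n)) (Suc s)) =
    card (spine_trees (Suc n) (Suc s)) + card (spine_trees (Suc (Suc n)) s)"
proof -
  let ?A = "Node Leaf () ` spine_trees (Suc n) (Suc s)"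
  let ?B = "rotate_left ` spine_trees (Suc (Suc n)) s"
  \<comment> \<open>At most \<open>n\<close> of the \<open>n + 2\<close> vertices are off the spine,
    so the root has a right child; otherwise its left subtree would put \<open>n + 1\<close>
    vertices off the spine. Hence \<open>rotate_left\<close> always acts by its first equation
    here.\<close>
  have two_on_spine: "\<exists>a b c. t = Node a () (Node b () c)"
    if t: "t \<in> spine_trees (Suc (Suc n)) s" for t
  proof (cases t rule: rotate_left.cases)
    case ("2_2" a x)
    with t assms show ?thesis by (auto simp: spine_trees_def)
  qed (use t in \<open>auto simp: spine_trees_def\<close>)
  have "t \<in> ?A \<union> ?B \<longleftrightarrow> t \<in> spine_trees (Suc (Suc n)) (Suc s)" for t
  proof
    assume "t \<in> ?A \<union> ?B"
    then show "t \<in> spine_trees (Suc (Suc n)) (Suc s)"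
      using two_on_spine by (fastforce simp: spine_trees_def)
  next
    assume t: "t \<in> spine_trees (Suc (Suc n)) (Suc s)"
    then obtain l r where lr: "t = Node l () r"
      by (cases t) (auto simp: spine_trees_def)
    show "t \<in> ?A \<union> ?B"
    proof (cases l)
      case Leaf
      with t lr show ?thesis by (auto simp: spine_trees_def)
    next
      case (Node a x b)
      with t lr have "Node a () (Node b () r) \<in> spine_trees (Suc (Suc n)) s"
        by (auto simp: spine_trees_def)
      moreover have "t = rotate_left (Node a () (Node b () r))"
        using lr Node by simp
      ultimately show ?thesis by blast
    qed
  qed
  then have "spine_trees (Suc (Suc n)) (Suc s) = ?A \<union> ?B"
    by blast
  \<comment> \<open>The root has no left child in \<open>?A\<close>, but has one in
    \<open>?B\<close>.\<close>
  moreover have "?A \<inter> ?B = {}"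
    using two_on_spine by fastforce
  moreover have "inj_on rotate_left (spine_trees (Suc (Suc n)) s)"
    by (rule inj_onI) (auto dest!: two_on_spine)
  moreover have "inj_on (Node Leaf ()) (spine_trees (Suc n) (Suc s))"
    by (simp add: inj_on_def)
  ultimately show ?thesis
    by (simp add: card_Un_disjoint finite_spine_trees card_image)
qed

text \<open>All left subtrees along the spine must be empty, which leaves only the path of right
  children.\<close>

lemma card_spine_trees_0: "card (spine_trees n 0) = 1"
proof (induction n)
  case 0
  have "spine_trees 0 0 = {Leaf}" by (auto simp: spine_trees_def)
  then show ?case by simp
next
  case (Suc n)
  have "t \<in> spine_trees (Suc n) 0 \<longleftrightarrow> t \<in> Node Leaf () ` spine_trees n 0" for t
    by (cases t) (auto simp: spine_trees_def)
  then have "spine_trees (Suc n) 0 = Node Leaf () ` spine_trees n 0"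
    by blast
  then show ?case using Suc by (simp add: card_image inj_on_def)
qed

text \<open>Since \<open>(n - s + 1) / (n + 1) = 1 - s / (n + 1)\<close>, absorption removes the
  quotient. In this ballot-number form Pascal's rule, applied to both binomials, yields the
  recurrence.\<close>

lemma catalan_triangle_eq_diff:
  "catalan_triangle n s = of_nat ((n + s) choose n) - of_nat ((n + s) choose Suc n)"
proof -
  have "Suc n * ((n + s) choose Suc n) = s * ((n + s) choose n)"
    using binomial_absorb_comp[of "n + s" n] binomial_absorption[of n "n + s"]
    by simp
  then have "(of_nat n + 1) * of_nat ((n + s) choose Suc n) =
      (of_nat s * of_nat ((n + s) choose n) :: rat)"
    by (metis of_nat_mult of_nat_Suc add.commute)
  moreover have "(of_nat n + 1 :: rat) \<noteq> 0"
    by (metis of_nat_Suc add.commute of_nat_eq_0_iff nat.distinct(1))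
  ultimately show ?thesis
    by (simp add: catalan_triangle_def field_simps)
qed

lemma catalan_triangle_0: "catalan_triangle n 0 = 1"
  by (simp add: catalan_triangle_eq_diff)

lemma catalan_triangle_Suc_self: "catalan_triangle n (Suc n) = 0"
  by (simp add: catalan_triangle_def)

lemma catalan_triangle_Suc_Suc:
  "catalan_triangle (Suc n) (Suc s) = catalan_triangle n (Suc s) + catalan_triangle (Suc n) s"
  by (simp add: catalan_triangle_eq_diff)

text \<open>Nested induction, as the recurrence lowers either \<open>n\<close> or \<open>s\<close>.
  The range includes \<open>s = n + 1\<close>, just outside the triangle, where both sides are 0:
  the recurrence for the last entry of the next row refers to that value.\<close>

lemma card_spine_trees:
  "s \<le> Suc n \<Longrightarrow> of_nat (card (spine_trees (Suc n) s)) = catalan_triangle n s"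
proof (induction n arbitrary: s)
  case 0
  then consider "s = 0" | "s = Suc 0" by linarith
  then show ?case
    by cases (simp_all add: card_spine_trees_0 catalan_triangle_0 spine_trees_empty
        catalan_triangle_Suc_self)
next
  case (Suc n)
  note IH_n = Suc.IH
  from Suc.prems show ?case
  proof (induction s)
    case 0
    then show ?case by (simp add: card_spine_trees_0 catalan_triangle_0)
  next
    case (Suc s)
    show ?case
    proof (cases "s = Suc n")
      case True
      then show ?thesis by (simp add: spine_trees_empty catalan_triangle_Suc_self)
    next
      case False
      with Suc.prems have "s \<le> n" by simp
      then show ?thesis
        using Suc.IH IH_n[of "Suc s"]
        by (simp add: card_spine_trees_Suc_Suc catalan_triangle_Suc_Suc)
    qed
  qed
qed

theorem theorem8:
  fixes n k :: nat
  assumes "k \<le> n"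
  shows "of_nat (card {(T :: unit tree, M :: side list set).
            size T = n + 1 \<and> M \<subseteq> vertices T \<and> card M = k \<and> M \<inter> right_spine T = {}})
         = borel_triangle n k"
proof -
  let ?X = "{T :: unit tree. size T = Suc n}"
  let ?M = "\<lambda>T :: unit tree. {M. M \<subseteq> vertices T - right_spine T \<and> card M = k}"
  have card_M: "card (?M T) = off_spine T choose k" for T
    by (simp add: n_subsets finite_vertices card_vertices_minus_right_spine)
  have "{(T :: unit tree, M :: side list set).
      size T = n + 1 \<and> M \<subseteq> vertices T \<and> card M = k \<and> M \<inter> right_spine T = {}} = Sigma ?X ?M"
    by auto
  also have "card \<dots> = (\<Sum>T\<in>?X. off_spine T choose k)"
    by (subst card_SigmaI) (auto simp: finite_trees_of_size finite_vertices simp flip: card_M)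
  \<comment> \<open>Grouping the trees by \<open>off_spine\<close> makes the summand constant on
    each group.\<close>
  also have "\<dots> = (\<Sum>s\<in>{0..n}. \<Sum>T\<in>{T \<in> ?X. off_spine T = s}. off_spine T choose k)"
  proof (rule sum.group[symmetric])
    show "off_spine ` ?X \<subseteq> {0..n}"
      by (auto dest: off_spine_le)
  qed (simp_all add: finite_trees_of_size)
  also have "\<dots> = (\<Sum>s\<in>{0..n}. (s choose k) * card (spine_trees (Suc n) s))"
    by (intro sum.cong) (auto simp: spine_trees_def)
  also have "\<dots> = (\<Sum>s = k..n. (s choose k) * card (spine_trees (Suc n) s))"
    by (rule sum.mono_neutral_right) auto
  finally show ?thesis
    by (simp add: borel_triangle_def card_spine_trees)
qed

end
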